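(* Let $n,m\geq 3$, let $\mathcal{T}=(t_{1},\ldots,t_{n})\in \mathcal{QS}(n)$ and $\mathcal{S}=(s_{1},\ldots,s_{m})\in \mathcal{QS}(m)$. Then $\mathcal{T}\circ_{i}\mathcal{S}\in \mathcal{QS}(n+m-1)$ for all $i\in\{1,\ldots,n\}$.
   Context: For $n\ge 3$, consider a plane convex $n$-gon whose vertices are labeled counterclockwise by $1,\ldots,n$. Given a triangulation of it (by pairwise non-crossing diagonals), let $t_i$ be the number of triangles of the triangulation incident with vertex $i$; the vector $(t_1,\ldots,t_n)$ is the quiddity sequence of the triangulation. $\mathcal{QS}(n)$ denotes the set of all quiddity sequences of triangulations of a plane convex $n$-gon. For $\mathcal{T}=(t_{1},\ldots,t_{n})$ and $\mathcal{S}=(s_{1},\ldots,s_{m})$ with $n,m\ge 3$ define, for $1\le i\le n-1$, $$\mathcal{T}\circ_{i}\mathcal{S}=(t_{1},\ldots,t_{i-1}, t_{i}+s_{1}+1,s_{2},\ldots,s_{m-1}, s_{m}+1, t_{i+1}+1,t_{i+2},\ldots,t_{n}),$$ and $$\mathcal{T}\circ_{n}\mathcal{S}=(t_{1}+1,t_{2},\ldots,t_{n-1}, t_{n}+s_{1}+1,s_{2},\ldots,s_{m-1}, s_{m}+1).$$ *)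

theory Defs
  imports "HOL-Analysis.Analysis"
begin

definition orientation :: "real \<times> real \<Rightarrow> real \<times> real \<Rightarrow> real \<times> real \<Rightarrow> real" where
  "orientation a b c = (fst b - fst a) * (snd c - snd a) - (snd b - snd a) * (fst c - fst a)"

text \<open>The vertices of an \<open>n\<close>-gon are \<open>v 1, \<dots>, v n\<close>; other values of \<open>v\<close> are ignored. Positive
  orientation of all triples says that the vertices are in strictly convex position (in particular
  distinct, with no three on a line) and are labelled counterclockwise.\<close>

definition convex_polygon :: "nat \<Rightarrow> (nat \<Rightarrow> real \<times> real) \<Rightarrow> bool" where
  "convex_polygon n v \<longleftrightarrow> 3 \<le> n \<and>
     (\<forall>i j k. 1 \<le> i \<and> i < j \<and> j < k \<and> k \<le> n \<longrightarrow> 0 < orientation (v i) (v j) (v k))"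

definition sides :: "nat \<Rightarrow> nat set set" where
  "sides n = insert {n, 1} {{i, i + 1} | i. 1 \<le> i \<and> i < n}"

definition diagonals :: "nat \<Rightarrow> nat set set" where
  "diagonals n = {{i, j} | i j. i \<in> {1..n} \<and> j \<in> {1..n} \<and> i \<noteq> j} - sides n"

definition crosses :: "(nat \<Rightarrow> real \<times> real) \<Rightarrow> nat set \<Rightarrow> nat set \<Rightarrow> bool" where
  "crosses v d e \<longleftrightarrow> (\<exists>i j k l. d = {i, j} \<and> e = {k, l} \<and>
     open_segment (v i) (v j) \<inter> open_segment (v k) (v l) \<noteq> {})"

definition noncrossing_diagonals :: "nat \<Rightarrow> (nat \<Rightarrow> real \<times> real) \<Rightarrow> nat set set \<Rightarrow> bool" where
  "noncrossing_diagonals n v D \<longleftrightarrow>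
     D \<subseteq> diagonals n \<and> pairwise (\<lambda>d e. \<not> crosses v d e) D"

text \<open>Pairwise non-crossing diagonals cut the polygon into triangles exactly if no further diagonal
  can be added.\<close>

definition triangulation :: "nat \<Rightarrow> (nat \<Rightarrow> real \<times> real) \<Rightarrow> nat set set \<Rightarrow> bool" where
  "triangulation n v D \<longleftrightarrow> noncrossing_diagonals n v D \<and>
     (\<forall>D'. noncrossing_diagonals n v D' \<and> D \<subseteq> D' \<longrightarrow> D' = D)"

text \<open>A triangle is given by its vertex set. As the vertices are in convex position, a triangle
  bounded by sides and diagonals of a triangulation \<open>D\<close> is not subdivided by any other diagonal of
  \<open>D\<close>, so it is one of the pieces.\<close>

definition triangles :: "nat \<Rightarrow> nat set set \<Rightarrow> nat set set" where
  "triangles n D = {t. t \<subseteq> {1..n} \<and> card t = 3 \<and>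
     (\<forall>i\<in>t. \<forall>j\<in>t. i \<noteq> j \<longrightarrow> {i, j} \<in> sides n \<union> D)}"

definition quiddity :: "nat \<Rightarrow> nat set set \<Rightarrow> nat list" where
  "quiddity n D = map (\<lambda>i. card {t \<in> triangles n D. i \<in> t}) [1..<n + 1]"

definition QS :: "nat \<Rightarrow> nat list set" where
  "QS n = {quiddity n D | v D. convex_polygon n v \<and> triangulation n v D}"

text \<open>The operation \<open>T \<circ>\<^sub>i S\<close>. Positions are counted from 1, so that \<open>t\<^sub>i\<close> is \<open>T ! (i - 1)\<close>;
  \<open>butlast (tl S)\<close> is \<open>s\<^sub>2, \<dots>, s\<^bsub>m-1\<^esub>\<close>. It is only meaningful for \<open>1 \<le> i \<le> length T\<close> and lists of
  length at least 3.\<close>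

definition glue :: "nat list \<Rightarrow> nat \<Rightarrow> nat list \<Rightarrow> nat list" where
  "glue T i S =
    (if i < length T
     then take (i - 1) T @ [T ! (i - 1) + hd S + 1] @ butlast (tl S) @ [last S + 1]
            @ [T ! i + 1] @ drop (i + 1) T
     else [hd T + 1] @ butlast (tl T) @ [last T + hd S + 1] @ butlast (tl S) @ [last S + 1])"

end

theory Submission
  imports Defs
begin

text \<open>In a convex polygon two diagonals cross exactly if their endpoints interlace, so triangulations
  and their quiddity sequences depend only on the indices of the vertices; any convex polygon, e.g. one
  inscribed in a parabola, realises them. The sequence \<open>T \<circ>\<^sub>i S\<close> comes from placing the \<open>m\<close>-gon next to
  the \<open>n\<close>-gon so that its first vertex is vertex \<open>i\<close>, with its other vertices between \<open>i\<close> and the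
  successor of \<open>i\<close>, and filling the gap by one triangle formed by \<open>i\<close>, the last vertex of the \<open>m\<close>-gon
  and the successor of \<open>i\<close>. The result is maximal because a chord that joins the two parts crosses a
  side of this triangle, unless it is the third side of it.\<close>

section \<open>Crossing diagonals as interlacing pairs of indices\<close>

definition chords :: "nat \<Rightarrow> nat set set" where
  "chords n = {{i, j} | i j. i \<in> {1..n} \<and> j \<in> {1..n} \<and> i < j}"

text \<open>The strict inequalities exclude chords with a common endpoint, and the disjunction makes
  the relation symmetric.\<close>

definition interlace :: "nat set \<Rightarrow> nat set \<Rightarrow> bool" where
  "interlace d e \<longleftrightarrow> (\<exists>a b c l. a < b \<and> b < c \<and> c < l \<and>
     (d = {a, c} \<and> e = {b, l} \<or> d = {b, l} \<and> e = {a, c}))"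

lemma interlace_commute: "interlace d e \<longleftrightarrow> interlace e d"
  unfolding interlace_def by blast

lemma interlace_doubletons:
  assumes "i < j" "k < l"
  shows "interlace {i, j} {k, l} \<longleftrightarrow> (i < k \<and> k < j \<and> j < l) \<or> (k < i \<and> i < l \<and> l < j)"
    (is "?L \<longleftrightarrow> ?R")
proof
  assume ?L
  then obtain a b c e where "a < b" "b < c" "c < e"
    and "{i, j} = {a, c} \<and> {k, l} = {b, e} \<or> {i, j} = {b, e} \<and> {k, l} = {a, c}"
    unfolding interlace_def by blast
  with assms show ?R
    by (auto simp: doubleton_eq_iff)
next
  assume ?R
  then show ?L
    unfolding interlace_def by blast
qed

lemma interlace_image:
  assumes "strict_mono f" "d \<in> chords n" "e \<in> chords n'"
  shows "interlace (f ` d) (f ` e) \<longleftrightarrow> interlace d e"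
proof -
  obtain i j k l where "d = {i, j}" "i < j" "e = {k, l}" "k < l"
    using assms(2,3) unfolding chords_def by blast
  with assms(1) show ?thesis
    by (simp add: interlace_doubletons strict_mono_less)
qed

lemma chordsE:
  assumes "e \<in> chords n"
  obtains i j where "e = {i, j}" "1 \<le> i" "i < j" "j \<le> n"
  using assms unfolding chords_def by auto

lemma chordsI: "x \<in> {1..n} \<Longrightarrow> y \<in> {1..n} \<Longrightarrow> x \<noteq> y \<Longrightarrow> {x, y} \<in> chords n"
  unfolding chords_def by (cases x y rule: linorder_cases) (fastforce simp: insert_commute)+

lemma chords_image:
  assumes "inj f" "f ` {1..n} \<subseteq> {1..N}" "e \<in> chords n"
  shows "f ` e \<in> chords N"
  using assms(3)
proof (rule chordsE)
  fix i j assume ij: "e = {i, j}" "1 \<le> i" "i < j" "j \<le> n"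
  then have "f i \<in> {1..N}" "f j \<in> {1..N}" "f i \<noteq> f j"
    using assms(1,2) by (auto simp: image_subset_iff dest: injD)
  then show ?thesis
    using ij(1) by (simp add: chordsI)
qed

lemma sides_subset_chords: "3 \<le> n \<Longrightarrow> sides n \<subseteq> chords n"
  unfolding sides_def by (auto intro!: chordsI)

lemma diagonals_eq: "diagonals n = chords n - sides n"
proof -
  have "{{i, j} | i j. i \<in> {1..n} \<and> j \<in> {1..n} \<and> i \<noteq> j} = chords n"
    by (auto intro: chordsI) (force simp: chords_def)
  then show ?thesis
    unfolding diagonals_def by simp
qed

text \<open>No index lies strictly between \<open>i\<close> and \<open>i + 1\<close>, and none lies
  outside the range from \<open>1\<close> to \<open>n\<close>, so a side never separates two
  endpoints.\<close>

lemma side_not_interlace: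
  assumes "3 \<le> n" "s \<in> sides n" "e \<in> chords n"
  shows "\<not> interlace s e"
proof -
  obtain k l where e: "e = {k, l}" "1 \<le> k" "k < l" "l \<le> n"
    using assms(3) by (rule chordsE)
  consider "s = {1, n}" | i where "s = {i, i + 1}" "1 \<le> i" "i < n"
    using assms(2) unfolding sides_def by auto
  then show ?thesis
    using e assms(1) by cases (auto simp: interlace_doubletons)
qed

subsection \<open>Convex polygons\<close>

lemma orientation_rotate: "orientation b c a = orientation a b c"
  unfolding orientation_def by (simp add: algebra_simps)

lemma orientation_swap: "orientation a c b = - orientation a b c"
  unfolding orientation_def by (simp add: algebra_simps)

lemma orientation_degenerate [simp]: "orientation a b a = 0" "orientation a b b = 0"
  unfolding orientation_def by (simp_all add: algebra_simps)

lemma orientation_convex_combination: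
  "orientation a b ((1 - u) *\<^sub>R p + u *\<^sub>R q) = (1 - u) * orientation a b p + u * orientation a b q"
  unfolding orientation_def by (simp add: algebra_simps)

lemma convex_polygonD:
  "convex_polygon n v \<Longrightarrow> 1 \<le> i \<Longrightarrow> i < j \<Longrightarrow> j < k \<Longrightarrow> k \<le> n \<Longrightarrow> 0 < orientation (v i) (v j) (v k)"
  unfolding convex_polygon_def by blast

text \<open>Some third vertex exists, and a triple with two equal points has orientation 0, against
  strict convexity.\<close>

lemma convex_polygon_distinct:
  assumes "convex_polygon n v" "1 \<le> i" "i < j" "j \<le> n"
  shows "v i \<noteq> v j"
proof
  assume eq: "v i = v j"
  have "3 \<le> n" using assms(1) unfolding convex_polygon_def by blast
  then obtain k where "1 \<le> k" "k \<le> n" "k \<noteq> i" "k \<noteq> j"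
    by (metis One_nat_def Suc_leI le_refl less_eq_Suc_le numeral_3_eq_3 le_SucI nat_neq_iff not_less_eq_eq)
  then consider "k < i" | "i < k" "k < j" | "j < k" by linarith
  then show False
    using convex_polygonD[OF assms(1), of k i j] convex_polygonD[OF assms(1), of i k j]
      convex_polygonD[OF assms(1), of i j k] assms(2-4) \<open>1 \<le> k\<close> \<open>k \<le> n\<close> eq
    by cases (auto simp: orientation_def algebra_simps)
qed

text \<open>The line through \<open>v i\<close> and \<open>v j\<close> separates the vertices
  numbered strictly between \<open>i\<close> and \<open>j\<close> from all others; rotating or
  swapping arguments reduces each sign to an increasing triple.\<close>

lemma convex_polygon_orientation_sgn:
  assumes "convex_polygon n v" "1 \<le> i" "i < j" "j \<le> n" "1 \<le> k" "k \<le> n"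
  shows "k < i \<or> j < k \<Longrightarrow> 0 < orientation (v i) (v j) (v k)"
    and "i < k \<Longrightarrow> k < j \<Longrightarrow> orientation (v i) (v j) (v k) < 0"
proof -
  show "0 < orientation (v i) (v j) (v k)" if "k < i \<or> j < k"
    using that convex_polygonD[OF assms(1), of k i j] convex_polygonD[OF assms(1), of i j k]
      orientation_rotate[of "v i" "v j" "v k"] assms by auto
  show "orientation (v i) (v j) (v k) < 0" if "i < k" "k < j"
    using convex_polygonD[OF assms(1), of i k j] that assms
      orientation_swap[of "v i" "v j" "v k"] by auto
qed

lemma convex_combination_nonzero:
  fixes a b w :: real
  assumes "0 < w" "w < 1" "0 \<le> a \<and> 0 \<le> b \<or> a \<le> 0 \<and> b \<le> 0" "a \<noteq> 0 \<or> b \<noteq> 0"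
  shows "(1 - w) * a + w * b \<noteq> 0"
proof -
  have *: "0 < (1 - w) * x + w * y" if "0 \<le> x" "0 \<le> y" "x \<noteq> 0 \<or> y \<noteq> 0" for x y
    using that assms(1,2)
    by (cases "x = 0") (auto intro!: add_pos_nonneg)
  show ?thesis
    using assms(3,4) *[of a b] *[of "- a" "- b"] by (auto simp: algebra_simps)
qed

text \<open>Orientation with respect to the line through \<open>v i\<close> and \<open>v j\<close>
  is affine and vanishes on the first segment. Without interlacing, \<open>v k\<close> and
  \<open>v l\<close> lie weakly on one side of that line, and not both on it, so the value is
  nonzero throughout the second open segment.\<close>

lemma open_segments_disjoint:
  assumes "convex_polygon n v" "1 \<le> i" "i < j" "j \<le> n" "1 \<le> k" "k < l" "l \<le> n"
    and "\<not> interlace {i, j} {k, l}" "{i, j} \<noteq> {k, l}"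
  shows "open_segment (v i) (v j) \<inter> open_segment (v k) (v l) = {}"
proof (rule ccontr)
  assume "\<not> ?thesis"
  then obtain p where p: "p \<in> open_segment (v i) (v j)" "p \<in> open_segment (v k) (v l)"
    by blast
  let ?o = "\<lambda>q. orientation (v i) (v j) q"
  obtain u where "p = (1 - u) *\<^sub>R v i + u *\<^sub>R v j"
    using p(1) unfolding in_segment by blast
  then have zero: "?o p = 0"
    by (simp only: orientation_convex_combination) simp
  obtain w where w: "0 < w" "w < 1" "p = (1 - w) *\<^sub>R v k + w *\<^sub>R v l"
    using p(2) unfolding in_segment by blast
  then have comb: "?o p = (1 - w) * ?o (v k) + w * ?o (v l)"
    by (simp only: orientation_convex_combination)
  have strict: "h < i \<or> j < h \<Longrightarrow> 0 < ?o (v h)" "i < h \<Longrightarrow> h < j \<Longrightarrow> ?o (v h) < 0"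
    if "1 \<le> h" "h \<le> n" for h
    using convex_polygon_orientation_sgn[OF assms(1-4) that] by auto
  have outside: "0 \<le> ?o (v h)" if "1 \<le> h" "h \<le> n" "h \<le> i \<or> j \<le> h" for h
    using strict(1)[OF that(1,2)] that(3) by (cases "h = i \<or> h = j") auto
  have inside: "?o (v h) \<le> 0" if "1 \<le> h" "h \<le> n" "i \<le> h" "h \<le> j" for h
    using strict(2)[OF that(1,2)] that(3,4) by (cases "h = i \<or> h = j") auto
  have nonzero: "?o (v h) \<noteq> 0" if "1 \<le> h" "h \<le> n" "h \<noteq> i" "h \<noteq> j" for h
    using strict[OF that(1,2)] that(3,4) by (cases "h < i \<or> j < h") auto
  have kl: "1 \<le> k" "k \<le> n" "1 \<le> l" "l \<le> n" using assms(5-7) by auto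
  have "(k \<le> i \<or> j \<le> k) \<and> (l \<le> i \<or> j \<le> l) \<or> (i \<le> k \<and> k \<le> j) \<and> (i \<le> l \<and> l \<le> j)"
    using assms(3,6,8) unfolding interlace_doubletons[OF assms(3,6)] by linarith
  then have "0 \<le> ?o (v k) \<and> 0 \<le> ?o (v l) \<or> ?o (v k) \<le> 0 \<and> ?o (v l) \<le> 0"
    using outside inside kl by blast
  moreover have "k \<noteq> i \<and> k \<noteq> j \<or> l \<noteq> i \<and> l \<noteq> j"
    using assms(3,6,9) by auto
  then have "?o (v k) \<noteq> 0 \<or> ?o (v l) \<noteq> 0"
    using nonzero kl by blast
  ultimately have "?o p \<noteq> 0"
    unfolding comb using w(1,2) convex_combination_nonzero by blast
  then show False using zero by simp
qed

text \<open>In a convex quadrilateral \<open>a b c d\<close> the diagonals meet in the point whose barycentric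
  coordinates are the areas of the triangles opposite to the vertices.\<close>

lemma open_segments_meet:
  assumes "convex_polygon n v" "1 \<le> i" "i < j" "j < k" "k < l" "l \<le> n"
  shows "open_segment (v i) (v k) \<inter> open_segment (v j) (v l) \<noteq> {}"
proof -
  define A where "A = orientation (v j) (v k) (v l)"
  define B where "B = orientation (v i) (v k) (v l)"
  define C where "C = orientation (v i) (v j) (v l)"
  define D where "D = orientation (v i) (v j) (v k)"
  have pos: "0 < A" "0 < B" "0 < C" "0 < D"
    unfolding A_def B_def C_def D_def using assms by (auto intro!: convex_polygonD[OF assms(1)])
  \<comment> \<open>Both sums are twice the area of the quadrilateral, cut along one diagonal or the
    other.\<close>
  have sum: "A + C = B + D"
    unfolding A_def B_def C_def D_def orientation_def by (simp add: algebra_simps)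
  have id: "A *\<^sub>R v i + C *\<^sub>R v k = B *\<^sub>R v j + D *\<^sub>R v l"
    unfolding A_def B_def C_def D_def orientation_def
    by (rule prod_eqI) (simp_all add: algebra_simps)
  define p where "p = (1 / (A + C)) *\<^sub>R (A *\<^sub>R v i + C *\<^sub>R v k)"
  have weights: "1 - C / (A + C) = A / (A + C)" "1 - D / (A + C) = B / (A + C)"
    using pos sum by (simp_all add: field_simps)
  have "p = (1 - C / (A + C)) *\<^sub>R v i + (C / (A + C)) *\<^sub>R v k"
    unfolding p_def weights by (simp add: scaleR_add_right)
  moreover have "p = (1 - D / (A + C)) *\<^sub>R v j + (D / (A + C)) *\<^sub>R v l"
    unfolding p_def weights id by (simp add: scaleR_add_right)
  moreover have "0 < C / (A + C)" "C / (A + C) < 1" "0 < D / (A + C)" "D / (A + C) < 1"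
    using pos sum by (auto simp: field_simps)
  moreover have "v i \<noteq> v k" "v j \<noteq> v l"
    using convex_polygon_distinct[OF assms(1), of i k] convex_polygon_distinct[OF assms(1), of j l]
      assms(2-6) by auto
  ultimately have "p \<in> open_segment (v i) (v k)" "p \<in> open_segment (v j) (v l)"
    unfolding in_segment by blast+
  then show ?thesis by blast
qed

text \<open>\<open>d \<noteq> e\<close> has to be required, since a chord meets itself along its
  open segment but does not interlace itself.\<close>

lemma crosses_iff_interlace:
  assumes "convex_polygon n v" "d \<in> chords n" "e \<in> chords n" "d \<noteq> e"
  shows "crosses v d e \<longleftrightarrow> interlace d e"
proof -
  obtain i j where d: "d = {i, j}" "1 \<le> i" "i < j" "j \<le> n"
    using assms(2) by (rule chordsE)
  obtain k l where e: "e = {k, l}" "1 \<le> k" "k < l" "l \<le> n"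
    using assms(3) by (rule chordsE)
  \<comment> \<open>Both namings of the endpoints give the same open segment, so one choice in
    \<open>crosses\<close> suffices.\<close>
  have "crosses v d e \<longleftrightarrow> open_segment (v i) (v j) \<inter> open_segment (v k) (v l) \<noteq> {}"
  proof
    show "open_segment (v i) (v j) \<inter> open_segment (v k) (v l) \<noteq> {}" if "crosses v d e"
      using that unfolding crosses_def d(1) e(1) doubleton_eq_iff
      by (metis open_segment_commute)
    show "crosses v d e" if "open_segment (v i) (v j) \<inter> open_segment (v k) (v l) \<noteq> {}"
      using that unfolding crosses_def d(1) e(1) by blast
  qed
  also have "\<dots> \<longleftrightarrow> interlace d e"
    using open_segments_disjoint[OF assms(1) d(2-4) e(2-4)] assms(4)
      open_segments_meet[OF assms(1), of i k j l] open_segments_meet[OF assms(1), of k i l j]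
      d e by (auto simp: interlace_doubletons Int_commute)
  finally show ?thesis .
qed

text \<open>On the parabola the orientation is the Vandermonde determinant of three increasing
  numbers.\<close>

lemma convex_polygon_parabola:
  assumes "3 \<le> n"
  shows "convex_polygon n (\<lambda>k. (real k, (real k)\<^sup>2))"
proof -
  have "0 < orientation (real i, (real i)\<^sup>2) (real j, (real j)\<^sup>2) (real k, (real k)\<^sup>2)"
    if "i < j" "j < k" for i j k
  proof -
    have "orientation (real i, (real i)\<^sup>2) (real j, (real j)\<^sup>2) (real k, (real k)\<^sup>2)
        = (real j - real i) * (real k - real i) * (real k - real j)"
      unfolding orientation_def by (simp add: algebra_simps power2_eq_square)
    then show ?thesis using that by simp
  qed
  then show ?thesis
    using assms unfolding convex_polygon_def by blast
qed

subsection \<open>Triangulations as maximal noncrossing sets of chords\<close>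

text \<open>Here the sides of the polygon belong to the set \<open>E\<close>, as no chord crosses them.\<close>

definition maximal_noncrossing :: "nat \<Rightarrow> nat set set \<Rightarrow> bool" where
  "maximal_noncrossing n E \<longleftrightarrow>
     E \<subseteq> chords n \<and> (\<forall>e\<in>chords n. e \<in> E \<longleftrightarrow> (\<forall>d\<in>E. \<not> interlace d e))"

lemma sides_subset_maximal_noncrossing:
  assumes "3 \<le> n" "maximal_noncrossing n E"
  shows "sides n \<subseteq> E"
  using assms side_not_interlace[OF assms(1)] sides_subset_chords[OF assms(1)] interlace_commute
  unfolding maximal_noncrossing_def by blast

lemma not_interlace_self: "d \<in> chords n \<Longrightarrow> \<not> interlace d d"
  by (erule chordsE) (simp add: interlace_doubletons)

lemma noncrossing_diagonals_iff:
  assumes "convex_polygon n v"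
  shows "noncrossing_diagonals n v D \<longleftrightarrow>
    D \<subseteq> chords n - sides n \<and> (\<forall>d\<in>D. \<forall>e\<in>D. \<not> interlace d e)"
proof -
  have "pairwise (\<lambda>d e. \<not> crosses v d e) D \<longleftrightarrow> (\<forall>d\<in>D. \<forall>e\<in>D. \<not> interlace d e)"
    if "D \<subseteq> chords n"
  proof -
    have "(d \<noteq> e \<longrightarrow> \<not> crosses v d e) \<longleftrightarrow> \<not> interlace d e" if "d \<in> D" "e \<in> D" for d e
      using crosses_iff_interlace[OF assms, of d e] not_interlace_self[of d]
        that \<open>D \<subseteq> chords n\<close> by blast
    then show ?thesis unfolding pairwise_def by (intro ball_cong refl) simp
  qed
  moreover have "D \<subseteq> chords n" if "D \<subseteq> chords n - sides n"
    using that by blast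
  ultimately show ?thesis
    unfolding noncrossing_diagonals_def diagonals_eq by metis
qed

text \<open>Inclusion-maximality becomes a membership test for single chords: a diagonal that
  interlaces no member could be inserted, and sides interlace nothing.\<close>

lemma triangulation_imp_maximal_noncrossing:
  assumes "convex_polygon n v" "triangulation n v D"
  shows "maximal_noncrossing n (sides n \<union> D)"
proof -
  have n: "3 \<le> n" using assms(1) unfolding convex_polygon_def by blast
  note side = side_not_interlace[OF n] sides_subset_chords[OF n]
  note nc = noncrossing_diagonals_iff[OF assms(1)]
  have D: "D \<subseteq> chords n - sides n" "\<forall>d\<in>D. \<forall>e\<in>D. \<not> interlace d e"
    and max: "noncrossing_diagonals n v D' \<Longrightarrow> D \<subseteq> D' \<Longrightarrow> D' = D" for D'
    using assms(2) unfolding triangulation_def nc by blast+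
  have "e \<in> D" if e: "e \<in> chords n" "e \<notin> sides n" "\<forall>d\<in>D. \<not> interlace d e" for e
  proof -
    have "noncrossing_diagonals n v (insert e D)"
      unfolding nc using D e not_interlace_self interlace_commute by blast
    then show ?thesis using max by blast
  qed
  then show ?thesis
    unfolding maximal_noncrossing_def using D side interlace_commute
    by (smt (verit) Diff_iff Un_iff subset_iff)
qed

lemma maximal_noncrossing_imp_triangulation:
  assumes "convex_polygon n v" "maximal_noncrossing n E"
  shows "triangulation n v (E - sides n)"
proof -
  have n: "3 \<le> n" using assms(1) unfolding convex_polygon_def by blast
  note nc = noncrossing_diagonals_iff[OF assms(1)]
  have E: "E \<subseteq> chords n" "\<And>e. e \<in> chords n \<Longrightarrow> e \<in> E \<longleftrightarrow> (\<forall>d\<in>E. \<not> interlace d e)"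
    using assms(2) unfolding maximal_noncrossing_def by blast+
  have "D' \<subseteq> E - sides n" if D': "noncrossing_diagonals n v D'" "E - sides n \<subseteq> D'" for D'
  proof
    fix e assume e: "e \<in> D'"
    have "e \<in> chords n" "e \<notin> sides n" "\<forall>d\<in>D'. \<not> interlace d e"
      using D'(1) e unfolding nc by auto
    \<comment> \<open>A member of \<open>E\<close> is either a diagonal, hence in \<open>D'\<close>,
      or a side.\<close>
    moreover from this have "\<not> interlace d e" if "d \<in> E" for d
      using that D'(2) side_not_interlace[OF n] by blast
    ultimately show "e \<in> E - sides n" using E(2) by blast
  qed
  moreover have "noncrossing_diagonals n v (E - sides n)"
    unfolding nc using E by blast
  ultimately show ?thesis
    unfolding triangulation_def by blast
qed

text \<open>Strictly monotone renumbering preserves interlacing, and membership in \<open>E\<close>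
  is decided by interlacing alone, so it can be tested on images under \<open>h\<close>.\<close>

lemma maximal_noncrossing_pullback:
  assumes "strict_mono h" "maximal_noncrossing n E" "x \<in> {1..n}" "y \<in> {1..n}" "x \<noteq> y"
    and "\<And>d. d \<in> E \<Longrightarrow> \<not> interlace (h ` d) {h x, h y}"
  shows "{x, y} \<in> E"
proof -
  have ch: "{x, y} \<in> chords n" using assms(3-5) by (rule chordsI)
  have "\<not> interlace d {x, y}" if "d \<in> E" for d
    using interlace_image[OF assms(1) _ ch, of d n] assms(2) assms(6)[OF that] that
    unfolding maximal_noncrossing_def by auto
  then show ?thesis
    using assms(2) ch unfolding maximal_noncrossing_def by blast
qed

section \<open>Triangles as triples of pairwise joined vertices\<close>

definition complete_triples :: "nat \<Rightarrow> nat set set \<Rightarrow> nat set set" where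
  "complete_triples n E = {t. t \<subseteq> {1..n} \<and> card t = 3 \<and> (\<forall>i\<in>t. \<forall>j\<in>t. i \<noteq> j \<longrightarrow> {i, j} \<in> E)}"

lemma complete_triples_image:
  assumes "inj h" "h ` {1..n} \<subseteq> {1..N}" "(`) h ` E \<subseteq> G" "t \<in> complete_triples n E"
  shows "h ` t \<in> complete_triples N G"
proof -
  have t: "t \<subseteq> {1..n}" "card t = 3" "\<And>a b. a \<in> t \<Longrightarrow> b \<in> t \<Longrightarrow> a \<noteq> b \<Longrightarrow> {a, b} \<in> E"
    using assms(4) unfolding complete_triples_def by auto
  have "{h a, h b} \<in> G" if "a \<in> t" "b \<in> t" "h a \<noteq> h b" for a b
  proof -
    have "h ` {a, b} \<in> G" using t(3)[of a b] that assms(3) by blast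
    then show ?thesis by simp
  qed
  moreover have "card (h ` t) = 3"
    using card_image[of h t] assms(1) t(2) inj_on_subset by (metis subset_UNIV)
  moreover have "h ` t \<subseteq> {1..N}" using t(1) assms(2) by blast
  ultimately show ?thesis unfolding complete_triples_def by auto
qed

text \<open>The last assumption says that between image vertices \<open>G\<close> has no edges
  beyond those coming from \<open>E\<close>, so a triple of \<open>G\<close> inside the image
  already is one of \<open>E\<close>, renumbered.\<close>

lemma complete_triples_pullback:
  assumes "inj h" "t \<in> complete_triples N G" "t \<subseteq> h ` {1..n}"
    and "\<And>x y. x \<in> {1..n} \<Longrightarrow> y \<in> {1..n} \<Longrightarrow> x \<noteq> y \<Longrightarrow> {h x, h y} \<in> G \<Longrightarrow> {x, y} \<in> E"
  shows "t \<in> (`) h ` complete_triples n E"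
proof -
  obtain s where s: "s \<subseteq> {1..n}" "t = h ` s"
    using assms(3) by (rule subset_imageE)
  have "card s = 3"
    using assms(1,2) s(2) card_image[of h s] inj_on_subset[of h UNIV s]
    unfolding complete_triples_def by simp
  moreover have "{a, b} \<in> E" if "a \<in> s" "b \<in> s" "a \<noteq> b" for a b
  proof (rule assms(4))
    show "{h a, h b} \<in> G"
      using assms(1,2) s(2) that unfolding complete_triples_def by (auto dest: injD)
  qed (use that s(1) in auto)
  ultimately have "s \<in> complete_triples n E"
    using s(1) unfolding complete_triples_def by blast
  then show ?thesis using s(2) by blast
qed

lemma finite_complete_triples: "finite (complete_triples n E)"
  by (rule finite_subset[of _ "Pow {1..n}"]) (auto simp: complete_triples_def)

definition triple_counts :: "nat \<Rightarrow> nat set set \<Rightarrow> nat list" where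
  "triple_counts n E = map (\<lambda>i. card {t \<in> complete_triples n E. i \<in> t}) [1..<n + 1]"

lemma length_triple_counts [simp]: "length (triple_counts n E) = n"
  unfolding triple_counts_def by simp

lemma nth_triple_counts:
  "k < n \<Longrightarrow> triple_counts n E ! k = card {t \<in> complete_triples n E. k + 1 \<in> t}"
  unfolding triple_counts_def by (simp del: upt_Suc)

lemma quiddity_eq: "quiddity n D = triple_counts n (sides n \<union> D)"
  unfolding quiddity_def triple_counts_def triangles_def complete_triples_def ..

text \<open>The coordinates disappear here: sides are added to or removed from the set of diagonals,
  and the parabola provides a polygon for every maximal noncrossing family.\<close>

lemma QS_eq:
  assumes "3 \<le> n"
  shows "QS n = {triple_counts n E | E. maximal_noncrossing n E}"
proof (intro equalityI subsetI)
  fix T assume "T \<in> QS n"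
  then show "T \<in> {triple_counts n E | E. maximal_noncrossing n E}"
    unfolding QS_def quiddity_eq using triangulation_imp_maximal_noncrossing by blast
next
  fix T assume "T \<in> {triple_counts n E | E. maximal_noncrossing n E}"
  then obtain E where E: "maximal_noncrossing n E" "T = triple_counts n E" by blast
  then have "T = quiddity n (E - sides n)"
    using sides_subset_maximal_noncrossing[OF assms E(1)]
    unfolding quiddity_eq by (simp add: Un_absorb1)
  then show "T \<in> QS n"
    using maximal_noncrossing_imp_triangulation[OF convex_polygon_parabola[OF assms] E(1)]
      convex_polygon_parabola[OF assms] unfolding QS_def by blast
qed

section \<open>Gluing two triangulations along a triangle\<close>

locale gluing =
  fixes n m i :: nat and E F :: "nat set set"
  assumes n: "3 \<le> n" and m: "3 \<le> m" and i: "1 \<le> i" "i \<le> n"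
    and E: "maximal_noncrossing n E" and F: "maximal_noncrossing m F"
begin

text \<open>\<open>f\<close> and \<open>g\<close> renumber the vertices of the first and the second polygon in the glued one.\<close>

definition f :: "nat \<Rightarrow> nat" where "f j = (if j \<le> i then j else j + m - 1)"

definition g :: "nat \<Rightarrow> nat" where "g j = j + i - 1"

text \<open>The cyclic successor of \<open>i + m - 1\<close>, which is the last vertex of the second polygon.\<close>

definition q :: nat where "q = (if i = n then 1 else i + m)"

text \<open>The three sides of the gap triangle are the inserted chord, the image
  \<open>{i, q}\<close> of a side of the first polygon, and the image \<open>{i, i + m - 1}\<close>
  of the closing side of the second.\<close>

definition G :: "nat set set" where
  "G = insert {i + m - 1, q} ((`) f ` E \<union> (`) g ` F)"

section \<open>Ranges of the renumberings and sides of the gap triangle\<close>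

lemma strict_mono_f: "strict_mono f"
  using m unfolding strict_mono_def f_def by auto

lemma strict_mono_g: "strict_mono g"
  using i unfolding strict_mono_def g_def by auto

lemmas inj_f = strict_mono_imp_inj_on[OF strict_mono_f]
lemmas inj_g = strict_mono_imp_inj_on[OF strict_mono_g]

lemma image_f: "f ` {1..n} = {1..i} \<union> {i + m..n + m - 1}"
proof (intro equalityI subsetI)
  fix x assume x: "x \<in> {1..i} \<union> {i + m..n + m - 1}"
  show "x \<in> f ` {1..n}"
  proof (cases "x \<le> i")
    case True
    then show ?thesis using x i by (intro image_eqI[of _ _ x]) (auto simp: f_def)
  next
    case False
    then show ?thesis using x m by (intro image_eqI[of _ _ "x - (m - 1)"]) (auto simp: f_def)
  qed
qed (use i m in \<open>auto simp: f_def split: if_splits\<close>)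

lemma image_g: "g ` {1..m} = {i..i + m - 1}"
proof (intro equalityI subsetI)
  fix x assume "x \<in> {i..i + m - 1}"
  then show "x \<in> g ` {1..m}"
    using i by (intro image_eqI[of _ _ "x - (i - 1)"]) (auto simp: g_def)
qed (use i m in \<open>auto simp: g_def\<close>)

lemma mem_image_f: "1 \<le> x \<Longrightarrow> x \<le> n + m - 1 \<Longrightarrow> x \<in> f ` {1..n} \<longleftrightarrow> x \<le> i \<or> i + m \<le> x"
  unfolding image_f by auto

lemma mem_image_g: "x \<in> g ` {1..m} \<longleftrightarrow> i \<le> x \<and> x < i + m"
  unfolding image_g using m by auto

lemma q_f: "q = f (if i = n then 1 else i + 1)"
  using m i unfolding q_def f_def by auto

lemma edge_f: "{i, q} \<in> (`) f ` E"
proof -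
  have "{i, if i = n then 1 else i + 1} \<in> sides n"
    using i by (auto simp: sides_def)
  then have "f ` {i, if i = n then 1 else i + 1} \<in> (`) f ` E"
    using sides_subset_maximal_noncrossing[OF n E] by blast
  then show ?thesis by (simp only: image_insert image_empty q_f[symmetric]) (simp add: f_def)
qed

lemma edge_g: "{i, i + m - 1} \<in> (`) g ` F"
proof -
  have "{m, 1} \<in> sides m" by (simp add: sides_def)
  then have "g ` {m, 1} \<in> (`) g ` F"
    using sides_subset_maximal_noncrossing[OF m F] by blast
  then show ?thesis using i by (simp add: g_def insert_commute add.commute)
qed

lemma N: "3 \<le> n + m - 1"
  using n m by linarith

text \<open>Being a side of the large polygon, the inserted chord interlaces no chord, so only
  images of chords need to be compared.\<close>

lemma center_side: "{i + m - 1, q} \<in> sides (n + m - 1)"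
proof (cases "i = n")
  case True
  then have "q = 1" unfolding q_def by simp
  then have "{i + m - 1, q} = {n + m - 1, 1}" using True by simp
  then show ?thesis unfolding sides_def by simp
next
  case False
  then have "{i + m - 1, q} = {i + m - 1, (i + m - 1) + 1}" "1 \<le> i + m - 1" "i + m - 1 < n + m - 1"
    using i m by (auto simp: q_def)
  then show ?thesis unfolding sides_def by blast
qed

section \<open>The glued chords form a maximal noncrossing family\<close>

lemma E_chords: "E \<subseteq> chords n" and F_chords: "F \<subseteq> chords m"
  using E F unfolding maximal_noncrossing_def by auto

lemma image_f_chord: "e \<in> chords n \<Longrightarrow> f ` e \<in> chords (n + m - 1)"
  by (rule chords_image[OF inj_f, where n = n]) (unfold image_f, use i m in auto)

lemma image_g_chord: "e \<in> chords m \<Longrightarrow> g ` e \<in> chords (n + m - 1)"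
  by (rule chords_image[OF inj_g, where n = m]) (unfold image_g, use i m in auto)

lemma G_chords: "G \<subseteq> chords (n + m - 1)"
proof -
  have "{i + m - 1, q} \<in> chords (n + m - 1)"
    using sides_subset_chords[OF N] center_side by blast
  then show ?thesis
    unfolding G_def using E_chords F_chords image_f_chord image_g_chord by blast
qed

text \<open>The second polygon occupies the consecutive block from \<open>i\<close> to
  \<open>i + m - 1\<close>, which the first meets only in \<open>i\<close>; so no vertex of the
  first lies strictly between two vertices of the second.\<close>

lemma not_interlace_f_g:
  assumes "d \<in> chords n" "e \<in> chords m"
  shows "\<not> interlace (f ` d) (g ` e)"
proof -
  obtain a b where d: "d = {a, b}" "1 \<le> a" "a < b" "b \<le> n"
    using assms(1) by (rule chordsE)
  obtain k l where e: "e = {k, l}" "1 \<le> k" "k < l" "l \<le> m"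
    using assms(2) by (rule chordsE)
  have "f a < f b" "g k < g l"
    using d e strict_mono_f strict_mono_g by (auto simp: strict_mono_less)
  moreover have "f a \<in> f ` {1..n}" "f b \<in> f ` {1..n}" "g k \<in> g ` {1..m}" "g l \<in> g ` {1..m}"
    using d e by auto
  ultimately show ?thesis
    using m unfolding d(1) e(1) image_f image_g by (auto simp: interlace_doubletons)
qed

lemma G_noncrossing:
  assumes "d \<in> G" "e \<in> G"
  shows "\<not> interlace d e"
proof -
  have nE: "\<not> interlace (f ` d') (f ` e')" if "d' \<in> E" "e' \<in> E" for d' e'
    using interlace_image[OF strict_mono_f] E_chords E that
    unfolding maximal_noncrossing_def by blast
  have nF: "\<not> interlace (g ` d') (g ` e')" if "d' \<in> F" "e' \<in> F" for d' e'
    using interlace_image[OF strict_mono_g] F_chords F that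
    unfolding maximal_noncrossing_def by blast
  have nEF: "\<not> interlace (f ` d') (g ` e')" "\<not> interlace (g ` e') (f ` d')"
    if "d' \<in> E" "e' \<in> F" for d' e'
    using not_interlace_f_g E_chords F_chords that interlace_commute by blast+
  have nc: "\<not> interlace {i + m - 1, q} x" "\<not> interlace x {i + m - 1, q}" if "x \<in> G" for x
    using side_not_interlace[OF N center_side, of x] G_chords that interlace_commute by blast+
  show ?thesis
    using assms nc nE nF nEF unfolding G_def by (elim insertE UnE imageE) auto
qed

text \<open>A chord with both ends in one polygon pulls back to it by maximality. Any other chord
  must not interlace the sides \<open>{i, q}\<close> and \<open>{i, i + m - 1}\<close> of the gap
  triangle, which leaves only the third side.\<close>

lemma G_maximal:
  assumes e: "e \<in> chords (n + m - 1)" and nc: "\<forall>d\<in>G. \<not> interlace d e"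
  shows "e \<in> G"
proof -
  obtain x y where xy: "e = {x, y}" "1 \<le> x" "x < y" "y \<le> n + m - 1"
    using e by (rule chordsE)
  consider "x \<in> f ` {1..n}" "y \<in> f ` {1..n}" | "x \<in> g ` {1..m}" "y \<in> g ` {1..m}"
    | "x \<notin> f ` {1..n} \<or> y \<notin> f ` {1..n}" "x \<notin> g ` {1..m} \<or> y \<notin> g ` {1..m}"
    by blast
  then show ?thesis
  proof cases
    case 1
    then obtain x' y' where x': "x = f x'" "y = f y'" "x' \<in> {1..n}" "y' \<in> {1..n}" by blast
    have "{x', y'} \<in> E"
    proof (rule maximal_noncrossing_pullback[OF strict_mono_f E x'(3,4)])
      show "x' \<noteq> y'" using xy(3) x'(1,2) by auto
      show "\<not> interlace (f ` d) {f x', f y'}" if "d \<in> E" for d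
        using nc that xy(1) x'(1,2) unfolding G_def by simp
    qed
    then have "f ` {x', y'} \<in> G" unfolding G_def by (intro insertI2 UnI1 imageI)
    then show ?thesis unfolding xy(1) x'(1,2) by simp
  next
    case 2
    then obtain x' y' where x': "x = g x'" "y = g y'" "x' \<in> {1..m}" "y' \<in> {1..m}" by blast
    have "{x', y'} \<in> F"
    proof (rule maximal_noncrossing_pullback[OF strict_mono_g F x'(3,4)])
      show "x' \<noteq> y'" using xy(3) x'(1,2) by auto
      show "\<not> interlace (g ` d) {g x', g y'}" if "d \<in> F" for d
        using nc that xy(1) x'(1,2) unfolding G_def by simp
    qed
    then have "g ` {x', y'} \<in> G" unfolding G_def by (intro insertI2 UnI2 imageI)
    then show ?thesis unfolding xy(1) x'(1,2) by simp
  next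
    case 3
    have "{i, q} \<in> G" "{i, i + m - 1} \<in> G"
      using edge_f edge_g unfolding G_def by simp_all
    then have 1: "\<not> interlace {i, q} {x, y}" and 2: "\<not> interlace {i, i + m - 1} {x, y}"
      using nc xy(1) by blast+
    \<comment> \<open>One end is a vertex of the second polygon other than \<open>i\<close>, and one
      end lies outside that polygon.\<close>
    have sep: "i < x \<and> x < i + m \<or> i < y \<and> y < i + m" "x < i \<or> i + m \<le> x \<or> y < i \<or> i + m \<le> y"
      using 3 mem_image_f[of x] mem_image_f[of y] mem_image_g[of x] mem_image_g[of y] xy(2-4)
      by linarith+
    have "i < i + m - 1" using m by simp
    note above = 2[unfolded interlace_doubletons[OF this xy(3)]]
    have "{x, y} = {i + m - 1, q}"
    proof (cases "i = n")
      \<comment> \<open>For \<open>i = n\<close> the successor wraps around to \<open>1\<close>, so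
        the outside end lies below \<open>i\<close> instead of above the block.\<close>
      case True
      then have "1 < i" using n by simp
      have "q = 1" unfolding q_def using True by simp
      then have "\<not> interlace {1, i} {x, y}" using 1 by (simp add: insert_commute)
      note below = this[unfolded interlace_doubletons[OF \<open>1 < i\<close> xy(3)]]
      have "x < i" "i < y" using sep xy(3,4) True by linarith+
      then have "x = 1" "y = i + m - 1"
        using below above xy(2,4) True by linarith+
      then show ?thesis using \<open>q = 1\<close> by auto
    next
      case False
      then have "i < q" "q = i + m" using m by (auto simp: q_def)
      note below = 1[unfolded interlace_doubletons[OF \<open>i < q\<close> xy(3)]]
      have "i < x" "x < i + m" "i + m \<le> y"
        using sep below xy(3) \<open>q = i + m\<close> by linarith+
      then have "x = i + m - 1" "y = i + m"
        using below above \<open>q = i + m\<close> by linarith+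
      then show ?thesis using \<open>q = i + m\<close> by simp
    qed
    then show ?thesis unfolding xy(1) G_def by simp
  qed
qed

lemma maximal_noncrossing_G: "maximal_noncrossing (n + m - 1) G"
  unfolding maximal_noncrossing_def using G_chords G_noncrossing G_maximal by blast

text \<open>An edge of \<open>G\<close> between image vertices interlaces no image of a member of
  \<open>E\<close>, so maximality of \<open>E\<close> forces it to come from \<open>E\<close>:
  gluing adds no edge inside the first polygon.\<close>

lemma pullback_f:
  assumes "x \<in> {1..n}" "y \<in> {1..n}" "x \<noteq> y" "{f x, f y} \<in> G"
  shows "{x, y} \<in> E"
  using strict_mono_f E assms(1-3)
proof (rule maximal_noncrossing_pullback)
  show "\<not> interlace (f ` d) {f x, f y}" if "d \<in> E" for d
    by (rule G_noncrossing) (use that assms(4) in \<open>auto simp: G_def\<close>)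
qed

lemma pullback_g:
  assumes "x \<in> {1..m}" "y \<in> {1..m}" "x \<noteq> y" "{g x, g y} \<in> G"
  shows "{x, y} \<in> F"
  using strict_mono_g F assms(1-3)
proof (rule maximal_noncrossing_pullback)
  show "\<not> interlace (g ` d) {g x, g y}" if "d \<in> F" for d
    by (rule G_noncrossing) (use that assms(4) in \<open>auto simp: G_def\<close>)
qed

section \<open>Triangles of the glued polygon\<close>

definition center :: "nat set" where
  "center = {i, i + m - 1, q}"

lemma i_in: "i \<in> f ` {1..n}" "i \<in> g ` {1..m}"
  unfolding image_f image_g using i m by auto

lemma last_in: "i + m - 1 \<notin> f ` {1..n}" "i + m - 1 \<in> g ` {1..m}"
  unfolding image_f image_g using i m by auto

lemma q_in: "q \<in> f ` {1..n}" "q \<notin> g ` {1..m}"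
  unfolding image_f image_g q_def using i n m by auto

lemma image_f_Int_image_g: "f ` {1..n} \<inter> g ` {1..m} = {i}"
  unfolding image_f image_g using i m by auto

text \<open>The image of an edge stays within its own polygon, so an edge contained in neither
  polygon can only be the inserted one; which end is which follows from \<open>q\<close> belonging
  to the first.\<close>

lemma mixed_edge:
  assumes "{a, b} \<in> G" "a \<notin> f ` {1..n}" "b \<notin> g ` {1..m}"
  shows "a = i + m - 1 \<and> b = q"
proof -
  have "f ` d \<subseteq> f ` {1..n}" if "d \<in> E" for d
    using that E_chords unfolding chords_def by fastforce
  then have "{a, b} \<notin> (`) f ` E" using assms(2) by blast
  moreover have "g ` d \<subseteq> g ` {1..m}" if "d \<in> F" for d
    using that F_chords unfolding chords_def by fastforce
  then have "{a, b} \<notin> (`) g ` F" using assms(3) by blast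
  ultimately have "{a, b} = {i + m - 1, q}"
    using assms(1) unfolding G_def by blast
  then show ?thesis
    using assms(2,3) q_in last_in by (metis doubleton_eq_iff)
qed

lemma center_complete: "center \<in> complete_triples (n + m - 1) G"
proof -
  have "{i, q} \<in> G" "{i, i + m - 1} \<in> G" "{i + m - 1, q} \<in> G"
    using edge_f edge_g unfolding G_def by simp_all
  moreover have "i \<noteq> q" "i \<noteq> i + m - 1" "i + m - 1 \<noteq> q"
    using i_in last_in q_in by metis+
  moreover have "center \<subseteq> {1..n + m - 1}"
    using i m unfolding center_def q_def by auto
  ultimately show ?thesis
    unfolding complete_triples_def center_def by (auto simp: insert_commute)
qed

text \<open>A triple contained in neither polygon has a vertex outside each;
  \<open>mixed_edge\<close> determines both, and any remaining vertex is either determined in the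
  same way or common to both polygons, hence \<open>i\<close>.\<close>

lemma complete_triples_G:
  "complete_triples (n + m - 1) G =
    (`) f ` complete_triples n E \<union> (`) g ` complete_triples m F \<union> {center}"
proof (intro equalityI subsetI)
  fix t assume t: "t \<in> complete_triples (n + m - 1) G"
  consider "t \<subseteq> f ` {1..n}" | "t \<subseteq> g ` {1..m}"
    | a b where "a \<in> t" "a \<notin> f ` {1..n}" "b \<in> t" "b \<notin> g ` {1..m}"
    by blast
  then show "t \<in> (`) f ` complete_triples n E \<union> (`) g ` complete_triples m F \<union> {center}"
  proof cases
    case 1
    then show ?thesis using complete_triples_pullback[OF inj_f t _ pullback_f] by blast
  next
    case 2
    then show ?thesis using complete_triples_pullback[OF inj_g t _ pullback_g] by blast
  next
    case 3
    have t': "t \<subseteq> {1..n + m - 1}" "card t = 3"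
      "\<And>x y. x \<in> t \<Longrightarrow> y \<in> t \<Longrightarrow> x \<noteq> y \<Longrightarrow> {x, y} \<in> G"
      using t unfolding complete_triples_def by auto
    have cover: "x \<in> f ` {1..n} \<or> x \<in> g ` {1..m}" if "x \<in> t" for x
    proof -
      have "x \<in> {1..n + m - 1}" using that t'(1) by blast
      then show ?thesis unfolding image_f image_g by auto
    qed
    \<comment> \<open>Since the images cover all vertices of \<open>t\<close>, \<open>x\<close> and
      \<open>y\<close> are distinct, so an edge of \<open>G\<close> joins them.\<close>
    have mixed: "x = i + m - 1 \<and> y = q"
      if "x \<in> t" "x \<notin> f ` {1..n}" "y \<in> t" "y \<notin> g ` {1..m}" for x y
      using mixed_edge[OF t'(3)[OF that(1,3)]] that cover by metis
    have "t \<subseteq> center"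
    proof
      fix c assume c: "c \<in> t"
      consider "c \<notin> f ` {1..n}" | "c \<notin> g ` {1..m}" | "c \<in> f ` {1..n} \<inter> g ` {1..m}"
        by blast
      then show "c \<in> center"
      proof cases
        case 1
        then show ?thesis using mixed[OF c _ 3(3,4)] unfolding center_def by blast
      next
        case 2
        then show ?thesis using mixed[OF 3(1,2) c] unfolding center_def by blast
      next
        case 3
        then show ?thesis unfolding image_f_Int_image_g center_def by blast
      qed
    qed
    moreover have "card center = 3"
      using center_complete unfolding complete_triples_def by blast
    moreover have "finite center" unfolding center_def by simp
    ultimately have "t = center"
      using t'(2) by (simp add: card_subset_eq)
    then show ?thesis by blast
  qed
next
  fix t assume "t \<in> (`) f ` complete_triples n E \<union> (`) g ` complete_triples m F \<union> {center}"
  moreover have fg: "f ` {1..n} \<subseteq> {1..n + m - 1}" "g ` {1..m} \<subseteq> {1..n + m - 1}"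
    unfolding image_f image_g using i m by auto
  moreover have EF: "(`) f ` E \<subseteq> G" "(`) g ` F \<subseteq> G" unfolding G_def by auto
  ultimately show "t \<in> complete_triples (n + m - 1) G"
    using complete_triples_image[OF inj_f fg(1) EF(1)] complete_triples_image[OF inj_g fg(2) EF(2)]
      center_complete by auto
qed

text \<open>The three families are disjoint: the polygons share a single vertex, so no triple lies
  in both, and \<open>center\<close> lies in neither.\<close>

lemma card_complete_triples_G:
  "card {t \<in> complete_triples (n + m - 1) G. k \<in> t} =
    card {t \<in> complete_triples n E. k \<in> f ` t} + card {t \<in> complete_triples m F. k \<in> g ` t}
      + of_bool (k \<in> center)"
proof -
  let ?A = "{t \<in> complete_triples n E. k \<in> f ` t}"
  let ?B = "{t \<in> complete_triples m F. k \<in> g ` t}"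
  let ?C = "if k \<in> center then {center} else {}"
  have sub_f: "f ` t \<subseteq> f ` {1..n}" if "t \<in> complete_triples n E" for t
    using that unfolding complete_triples_def by blast
  have sub_g: "g ` t \<subseteq> g ` {1..m}" "card (g ` t) = 3" if "t \<in> complete_triples m F" for t
    using that card_image[OF inj_on_subset[OF inj_g subset_UNIV], of t]
    unfolding complete_triples_def by auto
  have "(`) f ` ?A \<inter> (`) g ` ?B = {}"
  proof (rule ccontr)
    assume "\<not> ?thesis"
    then obtain s t where "s \<in> complete_triples n E" "t \<in> complete_triples m F" "f ` s = g ` t"
      by auto
    then have "g ` t \<subseteq> f ` {1..n} \<inter> g ` {1..m}" "card (g ` t) = 3"
      using sub_f[of s] sub_g[of t] by auto
    then have "g ` t \<subseteq> {i}" "card (g ` t) = 3"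
      unfolding image_f_Int_image_g by auto
    then show False using card_mono[of "{i}" "g ` t"] by simp
  qed
  moreover have "((`) f ` ?A \<union> (`) g ` ?B) \<inter> ?C = {}"
  proof -
    have "center \<noteq> f ` t" if "t \<in> complete_triples n E" for t
      using sub_f[OF that] last_in(1) unfolding center_def by blast
    moreover have "center \<noteq> g ` t" if "t \<in> complete_triples m F" for t
      using sub_g(1)[OF that] q_in(2) unfolding center_def by blast
    ultimately show ?thesis by auto
  qed
  moreover have "{t \<in> complete_triples (n + m - 1) G. k \<in> t} = ((`) f ` ?A \<union> (`) g ` ?B) \<union> ?C"
    unfolding complete_triples_G by auto
  moreover have "card ((`) f ` ?A) = card ?A" "card ((`) g ` ?B) = card ?B"
    using inj_f inj_g by (auto intro!: card_image inj_onI simp: inj_image_eq_iff)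
  moreover have "card ?C = of_bool (k \<in> center)" by simp
  moreover have "finite ((`) f ` ?A)" "finite ((`) g ` ?B)" "finite ?C"
    using finite_complete_triples by auto
  ultimately show ?thesis
    by (metis (no_types, lifting) card_Un_disjoint finite_Un)
qed

text \<open>\<open>k + 1 - m\<close> inverts \<open>f\<close> above the inserted block; the vertices
  with \<open>i < k\<close> and \<open>k < i + m\<close> are missed by \<open>f\<close>.\<close>

lemma card_f:
  "card {t \<in> complete_triples n E. k \<in> f ` t} =
    (if k \<le> i then card {t \<in> complete_triples n E. k \<in> t}
     else if i + m \<le> k then card {t \<in> complete_triples n E. k + 1 - m \<in> t} else 0)"
proof -
  consider (low) "k = f k" "k \<le> i" | (high) "k = f (k + 1 - m)" "i + m \<le> k"
    | (mid) "i < k" "k < i + m"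
  proof -
    have "k \<le> i \<Longrightarrow> k = f k" "i + m \<le> k \<Longrightarrow> k = f (k + 1 - m)"
      unfolding f_def using m by auto
    then show thesis using that by linarith
  qed
  then show ?thesis
  proof cases
    case low
    then show ?thesis using inj_image_mem_iff[OF inj_f, of k] by simp
  next
    case high
    then show ?thesis using inj_image_mem_iff[OF inj_f, of "k + 1 - m"] m by simp
  next
    case mid
    then have "k \<notin> f ` t" for t unfolding f_def by auto
    then show ?thesis using mid by simp
  qed
qed

lemma card_g:
  "card {t \<in> complete_triples m F. k \<in> g ` t} =
    (if i \<le> k \<and> k < i + m then card {t \<in> complete_triples m F. k + 1 - i \<in> t} else 0)"
proof (cases "i \<le> k \<and> k < i + m")
  case True
  then have "k = g (k + 1 - i)" unfolding g_def by simp
  then show ?thesis using True inj_image_mem_iff[OF inj_g, of "k + 1 - i"] by simp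
next
  case False
  have "k \<notin> g ` t" if "t \<in> complete_triples m F" for t
  proof -
    have "k \<notin> g ` {1..m}" unfolding image_g using False m by auto
    then show ?thesis using that unfolding complete_triples_def by blast
  qed
  then have "{t \<in> complete_triples m F. k \<in> g ` t} = {}" by blast
  then show ?thesis by (simp only: False if_False card.empty)
qed

end

section \<open>Entries of the glued sequence\<close>

lemma length_glue:
  assumes "1 \<le> i" "i \<le> length T" "3 \<le> length T" "3 \<le> length S"
  shows "length (glue T i S) = length T + length S - 1"
  using assms unfolding glue_def by auto

text \<open>Writing each entry as a sum of contributions from \<open>T\<close>, from
  \<open>S\<close> and from the gap triangle lets it match the triangle count term by term; at
  vertex \<open>i\<close> all three are present. Position \<open>k\<close> belongs to vertex
  \<open>k + 1\<close>.\<close>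

lemma nth_glue:
  assumes "1 \<le> i" "i \<le> length T" "3 \<le> length T" "3 \<le> length S" "k < length T + length S - 1"
  shows "glue T i S ! k =
    (if k < i then T ! k else if i + length S \<le> k + 1 then T ! (k + 1 - length S) else 0)
    + (if i \<le> k + 1 \<and> k + 1 < i + length S then S ! (k + 1 - i) else 0)
    + of_bool (k + 1 \<in> {i, i + length S - 1, if i = length T then 1 else i + length S})"
proof -
  have S: "hd S = S ! 0" "last S = S ! (length S - 1)" and T: "hd T = T ! 0" "last T = T ! (length T - 1)"
  proof -
    have "S \<noteq> []" "T \<noteq> []" using assms by auto
    then show "hd S = S ! 0" "last S = S ! (length S - 1)" "hd T = T ! 0" "last T = T ! (length T - 1)"
      by (simp_all add: hd_conv_nth last_conv_nth)
  qed
  have mid: "butlast (tl U) ! j = U ! (j + 1)" if "j < length U - 2" for j and U :: "nat list"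
    using that by (simp add: nth_butlast nth_tl)
  show ?thesis
  proof (cases "i < length T")
    case True
    \<comment> \<open>The cases follow the blocks of the concatenation in \<open>glue\<close> from
      left to right.\<close>
    consider "k + 1 < i" | "k + 1 = i" | "i < k + 1" "k + 1 < i + length S - 1"
      | "k + 1 = i + length S - 1" | "k + 1 = i + length S" | "i + length S < k + 1"
      by linarith
    then show ?thesis
      using True assms
      by cases (auto simp: glue_def S nth_append nth_Cons' mid Suc_diff_le)
  next
    case False
    then have "i = length T" using assms by simp
    \<comment> \<open>Here the successor of vertex \<open>i\<close> is the first vertex, so position
      \<open>0\<close> receives the extra 1.\<close>
    consider "k = 0" | "0 < k" "k + 1 < i" | "k = i - 1" | "i < k + 1" "k + 1 < i + length S - 1"
      | "k + 1 = i + length S - 1"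
      using assms \<open>i = length T\<close> by linarith
    then show ?thesis
      using \<open>i = length T\<close> assms
      by cases (auto simp: glue_def S T nth_append nth_Cons' mid Suc_diff_le)
  qed
qed

lemma (in gluing) glue_triple_counts:
  "glue (triple_counts n E) i (triple_counts m F) = triple_counts (n + m - 1) G"
proof (rule nth_equalityI)
  show "length (glue (triple_counts n E) i (triple_counts m F)) =
      length (triple_counts (n + m - 1) G)"
    using n m i by (simp add: length_glue)
next
  fix k assume "k < length (glue (triple_counts n E) i (triple_counts m F))"
  then have k: "k < n + m - 1" using n m i by (simp add: length_glue)
  have "triple_counts (n + m - 1) G ! k =
      (if k < i then triple_counts n E ! k
       else if i + m \<le> k + 1 then triple_counts n E ! (k + 1 - m) else 0)
      + (if i \<le> k + 1 \<and> k + 1 < i + m then triple_counts m F ! (k + 1 - i) else 0)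
      + of_bool (k + 1 \<in> center)"
    \<comment> \<open>The counts are taken at vertex \<open>k + 1\<close>, where the inverses of
      \<open>f\<close> and \<open>g\<close> give the list positions \<open>k + 1 - m\<close> and
      \<open>k + 1 - i\<close>.\<close>
    unfolding nth_triple_counts[OF k] card_complete_triples_G card_f card_g
    using k n m i by (auto simp: nth_triple_counts Suc_diff_le)
  then show "glue (triple_counts n E) i (triple_counts m F) ! k = triple_counts (n + m - 1) G ! k"
    using nth_glue[of i "triple_counts n E" "triple_counts m F" k] n m i k
    unfolding length_triple_counts center_def q_def by metis
qed

theorem theorem1:
  fixes n m i :: nat and T S :: "nat list"
  assumes "3 \<le> n" and "3 \<le> m"
    and "T \<in> QS n" and "S \<in> QS m"
    and "i \<in> {1..n}"
  shows "glue T i S \<in> QS (n + m - 1)"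
proof -
  obtain E where E: "maximal_noncrossing n E" "T = triple_counts n E"
    using assms(1,3) QS_eq by auto
  obtain F where F: "maximal_noncrossing m F" "S = triple_counts m F"
    using assms(2,4) QS_eq by auto
  interpret gl: gluing n m i E F
    using assms E F by unfold_locales auto
  show ?thesis
    unfolding QS_eq[OF gl.N] E(2) F(2)
    using gl.glue_triple_counts gl.maximal_noncrossing_G by blast
qed

end
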